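(* Let $d\ge3$ and $\mathscr L=\mathbb Z^dM_0$ with $M_0\in\mathrm{SL}(d,\mathbb R)$ be fixed. In every open realisation stratum $\mathcal U\subset(\mathbb{RP}^{d-1})^s$, the $\mathscr L$-nonresonant normal configurations form a conull dense $G_\delta$ subset of $\mathcal U$.
   Context: Vectors are row vectors. An open realisation stratum is a nonempty open subset $\mathcal U\subset(\mathbb{RP}^{d-1})^s$ such that, for every $([n_1],\dots,[n_s])\in\mathcal U$, unit representatives $n_\ell$ and support numbers $h_\ell$ can be chosen so that $\bigcap_{\ell=1}^s\{x\in\mathbb R^d:x\cdot n_\ell<h_\ell\}$ is a bounded full-dimensional polyhedron of the fixed labelled combinatorial type (with $s$ labelled facets having the normals $n_\ell$). For $[n_\ell]\in\mathbb{RP}^{d-1}$ with unit representative $n_\ell$, $R_\ell=I-2\,{}^tn_\ell n_\ell$ is the reflection in the hyperplane orthogonal to $n_\ell$. A word $w=\ell_1\cdots\ell_r$ in $\{1,\dots,s\}$ is reduced if adjacent letters are distinct, and $R_w=R_{\ell_1}\cdots R_{\ell_r}$. $\mathrm{PGL}(d,\mathbb R)=\mathrm{GL}(d,\mathbb R)/(\mathbb R^\times I)$, $[A]$ is the class of $A$, and $[A]\in\mathrm{PGL}(d,\mathbb Q)$ means that some nonzero scalar multiple of $A$ is rational. The normal configuration $([n_1],\dots,[n_s])$ is $\mathscr L$-nonresonant if $[M_0R_wM_0^{-1}]\notin\mathrm{PGL}(d,\mathbb Q)$ for every nonempty reduced word $w$. "Conull" refers to the standard smooth (Lebesgue) measure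 class on $(\mathbb{RP}^{d-1})^s$. *)

theory Defs
  imports "HOL-Analysis.Analysis"
begin

definition proj_rel :: "real ^ 'd \<Rightarrow> real ^ 'd \<Rightarrow> bool" where
  "proj_rel x y \<longleftrightarrow> x \<noteq> 0 \<and> y \<noteq> 0 \<and> (\<exists>c::real. c \<noteq> 0 \<and> y = c *\<^sub>R x)"

lemma part_equivp_proj_rel: "part_equivp (proj_rel :: real ^ 'd \<Rightarrow> real ^ 'd \<Rightarrow> bool)"
proof (rule part_equivpI)
  have "proj_rel (axis undefined 1 :: real ^ 'd) (axis undefined 1)"
    unfolding proj_rel_def by (auto simp: axis_eq_0_iff intro!: exI[of _ 1])
  then show "\<exists>x :: real ^ 'd. proj_rel x x" ..
  show "symp (proj_rel :: real ^ 'd \<Rightarrow> real ^ 'd \<Rightarrow> bool)"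
  proof (rule sympI)
    fix x y :: "real ^ 'd" assume "proj_rel x y"
    then obtain c where "x \<noteq> 0" "y \<noteq> 0" "c \<noteq> 0" "y = c *\<^sub>R x"
      unfolding proj_rel_def by blast
    then show "proj_rel y x"
      unfolding proj_rel_def by (auto intro!: exI[of _ "inverse c"])
  qed
  show "transp (proj_rel :: real ^ 'd \<Rightarrow> real ^ 'd \<Rightarrow> bool)"
  proof (rule transpI)
    fix x y z :: "real ^ 'd" assume "proj_rel x y" "proj_rel y z"
    then obtain c e where "x \<noteq> 0" "z \<noteq> 0" "c \<noteq> 0" "y = c *\<^sub>R x" "e \<noteq> 0" "z = e *\<^sub>R y"
      unfolding proj_rel_def by blast
    then show "proj_rel x z"
      unfolding proj_rel_def by (auto intro!: exI[of _ "e * c"])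
  qed
qed

text \<open>The type \<open>'d rproj\<close> is the projective space of lines in \<open>real ^ 'd\<close>, of
  dimension \<open>CARD('d) - 1\<close>. The class \<open>proj x\<close> is meaningful only for \<open>x \<noteq> 0\<close>.\<close>

quotient_type (overloaded) 'd rproj = "real ^ 'd" / partial: proj_rel
  morphisms rep_rproj proj
  by (rule part_equivp_proj_rel)

text \<open>Quotient topology from the nonzero vectors; configurations, of type
  \<open>'d rproj ^ 's\<close>, then carry the product topology.\<close>

instantiation rproj :: (finite) topological_space
begin

definition open_rproj :: "'a rproj set \<Rightarrow> bool" where
  "open_rproj U \<longleftrightarrow> open {x :: real ^ 'a. x \<noteq> 0 \<and> proj x \<in> U}"

instance
proof
  have "{x :: real ^ 'a. x \<noteq> 0 \<and> proj x \<in> UNIV} = - {0}" by auto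
  then show "open (UNIV :: 'a rproj set)" unfolding open_rproj_def by (simp add: open_Compl)
next
  fix S T :: "'a rproj set" assume "open S" "open T"
  moreover have "{x :: real ^ 'a. x \<noteq> 0 \<and> proj x \<in> S \<inter> T}
      = {x. x \<noteq> 0 \<and> proj x \<in> S} \<inter> {x. x \<noteq> 0 \<and> proj x \<in> T}" by auto
  ultimately show "open (S \<inter> T)" unfolding open_rproj_def by (simp add: open_Int)
next
  fix K :: "'a rproj set set" assume K: "\<forall>S\<in>K. open S"
  have "{x :: real ^ 'a. x \<noteq> 0 \<and> proj x \<in> \<Union>K} = (\<Union>S\<in>K. {x. x \<noteq> 0 \<and> proj x \<in> S})" by auto
  then show "open (\<Union>K)" using K unfolding open_rproj_def by (simp add: open_UN)
qed

end

text \<open>The measure class of the smooth manifold \<open>'d rproj ^ 's\<close>: a set is null iff it is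
  Lebesgue null in every product of standard affine charts. For a choice of pivots
  \<open>p\<close>, the chart domain consists of the configurations whose \<open>l\<close>-th line has nonzero
  \<open>p l\<close>-th coordinate; normalising that coordinate to 1 leaves the coordinates in
  \<open>chart_index p\<close> free. The map \<open>chart_inv p\<close> is the inverse of the chart.\<close>

definition chart_index :: "('s \<Rightarrow> 'd) \<Rightarrow> ('s \<times> 'd) set" where
  "chart_index p = {(l, j). j \<noteq> p l}"

definition chart_inv :: "('s::finite \<Rightarrow> 'd::finite) \<Rightarrow> ('s \<times> 'd \<Rightarrow> real) \<Rightarrow> 'd rproj ^ 's" where
  "chart_inv p y = (\<chi> l. proj (\<chi> j. if j = p l then 1 else y (l, j)))"

definition smooth_null :: "('d::finite rproj ^ 's::finite) set \<Rightarrow> bool" where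
  "smooth_null N \<longleftrightarrow>
     (\<forall>p. let M = Pi\<^sub>M (chart_index p) (\<lambda>_. lborel) in
        {y \<in> space M. chart_inv p y \<in> N} \<in> null_sets (completion M))"

definition open_polyhedron :: "('s::finite \<Rightarrow> real ^ 'd) \<Rightarrow> ('s \<Rightarrow> real) \<Rightarrow> (real ^ 'd) set" where
  "open_polyhedron n h = (\<Inter>l. {x. x \<bullet> n l < h l})"

definition labelled_facet ::
    "('s::finite \<Rightarrow> real ^ 'd) \<Rightarrow> ('s \<Rightarrow> real) \<Rightarrow> 's \<Rightarrow> (real ^ 'd) set" where
  "labelled_facet n h l = closure (open_polyhedron n h) \<inter> {x. x \<bullet> n l = h l}"

text \<open>Bijectivity says that each label gives a facet, that distinct labels give distinct
  facets, and that there are no other facets.\<close>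

definition labelled_polytope :: "('s::finite \<Rightarrow> real ^ 'd) \<Rightarrow> ('s \<Rightarrow> real) \<Rightarrow> bool" where
  "labelled_polytope n h \<longleftrightarrow>
     (\<forall>l. norm (n l) = 1) \<and>
     bounded (open_polyhedron n h) \<and>
     aff_dim (open_polyhedron n h) = int CARD('d) \<and>
     bij_betw (labelled_facet n h) UNIV {F. F facet_of closure (open_polyhedron n h)}"

definition polytope_faces :: "('s::finite \<Rightarrow> real ^ 'd) \<Rightarrow> ('s \<Rightarrow> real) \<Rightarrow> (real ^ 'd) set set" where
  "polytope_faces n h = {F. F face_of closure (open_polyhedron n h)}"

text \<open>Equality of labelled combinatorial types: an isomorphism of face lattices that
  respects the labels of the facets.\<close>

definition same_labelled_type ::
    "('s::finite \<Rightarrow> real ^ 'd) \<Rightarrow> ('s \<Rightarrow> real) \<Rightarrow> ('s \<Rightarrow> real ^ 'd) \<Rightarrow> ('s \<Rightarrow> real) \<Rightarrow> bool" where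
  "same_labelled_type n h n' h' \<longleftrightarrow>
     (\<exists>\<phi>. bij_betw \<phi> (polytope_faces n h) (polytope_faces n' h') \<and>
        (\<forall>F\<in>polytope_faces n h. \<forall>G\<in>polytope_faces n h. \<phi> F \<subseteq> \<phi> G \<longleftrightarrow> F \<subseteq> G) \<and>
        (\<forall>l. \<phi> (labelled_facet n h l) = labelled_facet n' h' l))"

text \<open>The fixed labelled combinatorial type is that of the reference polytope given by
  \<open>n\<^sub>0\<close> and \<open>h\<^sub>0\<close>.\<close>

definition open_realisation_stratum :: "('d::finite rproj ^ 's::finite) set \<Rightarrow> bool" where
  "open_realisation_stratum U \<longleftrightarrow>
     open U \<and> U \<noteq> {} \<and>
     (\<exists>n\<^sub>0 h\<^sub>0. labelled_polytope n\<^sub>0 h\<^sub>0 \<and>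
        (\<forall>c\<in>U. \<exists>n h. (\<forall>l. norm (n l) = 1 \<and> c $ l = proj (n l)) \<and>
           labelled_polytope n h \<and> same_labelled_type n\<^sub>0 h\<^sub>0 n h))"

definition unit_reflection :: "real ^ 'd \<Rightarrow> real ^ 'd ^ 'd" where
  "unit_reflection n = mat 1 - 2 *\<^sub>R (\<chi> i j. n $ i * n $ j)"

text \<open>The unit representative \<open>sgn x\<close> of the class of \<open>x\<close> is determined up to sign.\<close>

lift_definition reflection :: "'d::finite rproj \<Rightarrow> real ^ 'd ^ 'd"
  is "\<lambda>x. unit_reflection (sgn x)"
proof -
  fix x y :: "real ^ 'd" assume "proj_rel x y"
  then obtain c where c: "c \<noteq> 0" "y = c *\<^sub>R x" unfolding proj_rel_def by blast
  then have "sgn y = sgn x \<or> sgn y = - sgn x"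
    by (cases "c > 0") (auto simp: sgn_scaleR)
  then show "unit_reflection (sgn x) = unit_reflection (sgn y)"
    unfolding unit_reflection_def by auto
qed

definition word_reflection :: "'d::finite rproj ^ 's::finite \<Rightarrow> 's list \<Rightarrow> real ^ 'd ^ 'd" where
  "word_reflection c w = foldr (\<lambda>l A. reflection (c $ l) ** A) w (mat 1)"

text \<open>For invertible \<open>A\<close>, this says that the class of \<open>A\<close> in \<open>PGL(d, \<real>)\<close> lies in
  \<open>PGL(d, \<rat>)\<close>.\<close>

definition projectively_rational :: "real ^ 'd ^ 'd \<Rightarrow> bool" where
  "projectively_rational A \<longleftrightarrow> (\<exists>c::real. c \<noteq> 0 \<and> (\<forall>i j. (c *\<^sub>R A) $ i $ j \<in> \<rat>))"

text \<open>Nonresonance for the lattice spanned over the integers by the rows of \<open>M\<^sub>0\<close>;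
  \<open>distinct_adj w\<close> says that the word is reduced.\<close>

definition nonresonant :: "real ^ 'd ^ 'd \<Rightarrow> 'd::finite rproj ^ 's::finite \<Rightarrow> bool" where
  "nonresonant M\<^sub>0 c \<longleftrightarrow>
     (\<forall>w. w \<noteq> [] \<and> distinct_adj w \<longrightarrow>
        \<not> projectively_rational (M\<^sub>0 ** word_reflection c w ** matrix_inv M\<^sub>0))"

end

theory Submission
  imports Defs
begin

text \<open>A configuration is resonant iff, for some nonempty reduced word \<open>w\<close> and some
  invertible rational matrix \<open>Q\<close>, the conjugated word \<open>M R\<^sub>w M\<inverse>\<close> is proportional to \<open>Q\<close>.
  There are countably many pairs \<open>(w, Q)\<close>, and each of these conditions is closed, because
  proportionality is the vanishing of finitely many minors of a matrix that depends
  continuously on the configuration. Hence the nonresonant configurations form a \<open>G\<^sub>\<delta>\<close>.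
  It remains to show that each condition defines a null set; density then follows, since a
  nonempty open set of configurations is never null.

  In an affine chart, after clearing the denominators \<open>n \<bullet> n\<close> of the reflections, the
  condition for \<open>(w, Q)\<close> becomes a system of polynomial equations, and the zero set of a
  polynomial that is not identically zero is null (\<open>polyfun_zeros_null\<close>). So it suffices
  to find one point, possibly complex, at which the equations fail. Over the complex numbers
  take isotropic normals, no two of them orthogonal (\<open>isotropic_family\<close>). At an isotropic
  \<open>n\<close> the cleared reflection \<open>(n \<bullet> n) I - 2 n n\<^sup>T\<close> is just \<open>- 2 n n\<^sup>T\<close>, so the word
  collapses to a nonzero multiple of \<open>n n'\<^sup>T\<close>, with \<open>n\<close> and \<open>n'\<close> the normals of its first
  and last letter: the scalar factors \<open>n\<^sub>l \<bullet> n\<^sub>l\<^sub>'\<close> come from adjacent, hence distinct,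
  letters (\<open>cleared_word_isotropic\<close>). A nonzero matrix of rank one is not proportional
  to the invertible matrix \<open>Q\<close>.

  The hypothesis \<open>d \<ge> 3\<close> is used for the isotropic normals: in dimension two there are only
  two isotropic lines, and indeed every product of three plane reflections is an involution,
  so that a reduced word such as \<open>123123\<close> is the identity for all normals.\<close>

section \<open>Zero sets of polynomial functions\<close>

text \<open>Polynomial functions with complex arguments, so that nonvanishing may be tested at
  complex points while the zero sets of interest are real.\<close>

inductive polyfun :: "(('i \<Rightarrow> complex) \<Rightarrow> complex) \<Rightarrow> bool" where
  polyfun_const: "polyfun (\<lambda>v. a)"
| polyfun_coord: "polyfun (\<lambda>v. v i)"
| polyfun_add: "polyfun F \<Longrightarrow> polyfun G \<Longrightarrow> polyfun (\<lambda>v. F v + G v)"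
| polyfun_mult: "polyfun F \<Longrightarrow> polyfun G \<Longrightarrow> polyfun (\<lambda>v. F v * G v)"

lemma polyfun_diff: "polyfun F \<Longrightarrow> polyfun G \<Longrightarrow> polyfun (\<lambda>v. F v - G v)"
  using polyfun_add[of F "\<lambda>v. (-1) * G v"] polyfun_mult[OF polyfun_const[of "-1"], of G] by simp

lemma polyfun_sum: "(\<And>x. x \<in> A \<Longrightarrow> polyfun (F x)) \<Longrightarrow> polyfun (\<lambda>v. \<Sum>x\<in>A. F x v)"
  by (induction A rule: infinite_finite_induct) (auto intro: polyfun_const polyfun_add)

text \<open>Reading a polynomial function as a univariate polynomial in one coordinate. The
  coefficients are again polynomial functions, which drives the induction below.\<close>

lemma polyfun_slice:
  assumes "polyfun F"
  shows "\<exists>G. (\<forall>k. polyfun (\<lambda>v. coeff (G v) k)) \<and> (\<forall>v t. F (v(i := t)) = poly (G v) t)"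
  using assms
proof induction
  case (polyfun_const a)
  show ?case
    by (rule exI[of _ "\<lambda>v. [:a:]"]) (auto simp: polyfun.polyfun_const)
next
  case (polyfun_coord j)
  show ?case
  proof (cases "j = i")
    case True
    then show ?thesis
      by (intro exI[of _ "\<lambda>v. [:0, 1:]"]) (auto simp: polyfun.polyfun_const)
  next
    case False
    have "polyfun (\<lambda>v. coeff [:v j:] k)" for k
      by (cases k) (auto intro: polyfun.intros)
    then show ?thesis using False
      by (intro exI[of _ "\<lambda>v. [:v j:]"]) auto
  qed
next
  case (polyfun_add F1 F2)
  then obtain G1 G2 where
    "\<forall>k. polyfun (\<lambda>v. coeff (G1 v) k)" "\<forall>v t. F1 (v(i := t)) = poly (G1 v) t"
    "\<forall>k. polyfun (\<lambda>v. coeff (G2 v) k)" "\<forall>v t. F2 (v(i := t)) = poly (G2 v) t" by blast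
  then show ?case
    by (intro exI[of _ "\<lambda>v. G1 v + G2 v"]) (auto intro: polyfun.polyfun_add simp del: fun_upd_apply)
next
  case (polyfun_mult F1 F2)
  then obtain G1 G2 where
    "\<forall>k. polyfun (\<lambda>v. coeff (G1 v) k)" "\<forall>v t. F1 (v(i := t)) = poly (G1 v) t"
    "\<forall>k. polyfun (\<lambda>v. coeff (G2 v) k)" "\<forall>v t. F2 (v(i := t)) = poly (G2 v) t" by blast
  then show ?case
    by (intro exI[of _ "\<lambda>v. G1 v * G2 v"])
      (auto simp: coeff_mult simp del: fun_upd_apply intro!: polyfun_sum polyfun.polyfun_mult)
qed

definition real_slice :: "'i set \<Rightarrow> ('i \<Rightarrow> complex) \<Rightarrow> ('i \<Rightarrow> real) \<Rightarrow> 'i \<Rightarrow> complex" where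
  "real_slice J z y = (\<lambda>i. if i \<in> J then of_real (y i) else z i)"

lemma polyfun_real_slice_measurable:
  assumes "polyfun F"
  shows "(\<lambda>y. F (real_slice J z y)) \<in> borel_measurable (Pi\<^sub>M J (\<lambda>_. lborel))"
  using assms
proof induction
  case (polyfun_coord i)
  show ?case
  proof (cases "i \<in> J")
    case True
    then have "(\<lambda>y. y i) \<in> borel_measurable (Pi\<^sub>M J (\<lambda>_. lborel :: real measure))"
      using measurable_component_singleton[of i J "\<lambda>_. lborel :: real measure"] by simp
    then show ?thesis using True by (simp add: real_slice_def)
  qed (simp add: real_slice_def)
qed simp_all

text \<open>Add the real coordinates one at a time. If \<open>F z \<noteq> 0\<close>, then some coefficient of \<open>F\<close>
  as a polynomial in the new coordinate \<open>i\<close> is nonzero at \<open>z\<close>. By induction that coefficient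
  is nonzero for almost all values of the other coordinates; for each of these, \<open>F\<close> has
  finitely many zeros in the coordinate \<open>i\<close>, and Fubini applies.\<close>

lemma polyfun_zeros_null:
  assumes "finite J" "polyfun F" "F z \<noteq> 0"
  shows "{y \<in> space (Pi\<^sub>M J (\<lambda>_. lborel)). F (real_slice J z y) = 0} \<in> null_sets (Pi\<^sub>M J (\<lambda>_. lborel))"
  using assms
proof (induction J arbitrary: F rule: finite_induct)
  case empty
  then have "{y \<in> space (Pi\<^sub>M {} (\<lambda>_. lborel)). F (real_slice {} z y) = 0} = {}"
    by (auto simp: real_slice_def)
  then show ?case by (simp only: null_sets.empty_sets)
next
  case (insert i J)
  interpret product_sigma_finite "\<lambda>_ :: 'a. lborel :: real measure" ..
  let ?M = "\<lambda>J. Pi\<^sub>M J (\<lambda>_. lborel :: real measure)"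
  obtain G where G: "\<And>k. polyfun (\<lambda>v. coeff (G v) k)" "\<And>v t. F (v(i := t)) = poly (G v) t"
    using polyfun_slice[OF insert.prems(1)] by blast
  have "poly (G z) (z i) \<noteq> 0" using G(2)[of z "z i"] insert.prems by simp
  then have "G z \<noteq> 0" by auto
  then obtain k where "coeff (G z) k \<noteq> 0" using leading_coeff_0_iff by blast
  then have ae: "AE y in ?M J. coeff (G (real_slice J z y)) k \<noteq> 0"
    by (intro AE_I'[OF insert.IH[OF G(1)]]) auto
  let ?N = "{y \<in> space (?M (insert i J)). F (real_slice (insert i J) z y) = 0}"
  have N: "?N \<in> sets (?M (insert i J))"
    using polyfun_real_slice_measurable[OF insert.prems(1), of "insert i J" z]
    by measurable
  have inner: "(\<integral>\<^sup>+t. indicator ?N (y(i := t)) \<partial>lborel) = 0"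
    if nz: "coeff (G (real_slice J z y)) k \<noteq> 0" for y
  proof -
    let ?Z = "{t :: real. poly (G (real_slice J z y)) (of_real t) = 0}"
    have "G (real_slice J z y) \<noteq> 0" using nz by auto
    then have "finite ((of_real :: real \<Rightarrow> complex) -` {t. poly (G (real_slice J z y)) t = 0})"
      by (intro finite_vimageI poly_roots_finite) (auto simp: inj_on_def)
    then have "finite ?Z" by (simp add: vimage_def)
    then have "?Z \<in> null_sets lborel" by (rule finite_imp_null_set_lborel)
    then have "AE t in lborel. t \<notin> ?Z" by (rule AE_not_in)
    moreover have "indicator ?N (y(i := t)) = (0 :: ennreal)" if "t \<notin> ?Z" for t
    proof -
      have "real_slice (insert i J) z (y(i := t)) = (real_slice J z y)(i := of_real t)"
        by (auto simp: real_slice_def)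
      then show ?thesis using that G(2) by simp
    qed
    ultimately have "AE t in lborel. indicator ?N (y(i := t)) = (0 :: ennreal)"
      by (auto elim: eventually_mono)
    then have "(\<integral>\<^sup>+t. indicator ?N (y(i := t)) \<partial>lborel) = (\<integral>\<^sup>+t. 0 \<partial>(lborel :: real measure))"
      by (rule nn_integral_cong_AE)
    then show ?thesis by simp
  qed
  have "emeasure (?M (insert i J)) ?N = (\<integral>\<^sup>+y. indicator ?N y \<partial>?M (insert i J))"
    using N by simp
  also have "\<dots> = (\<integral>\<^sup>+y. (\<integral>\<^sup>+t. indicator ?N (y(i := t)) \<partial>lborel) \<partial>?M J)"
    by (rule product_nn_integral_insert) (use insert.hyps N in auto)
  also have "\<dots> = (\<integral>\<^sup>+y. 0 \<partial>?M J)"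
    by (rule nn_integral_cong_AE) (use ae inner in \<open>auto elim: eventually_mono\<close>)
  finally show ?case using N by (auto simp: null_sets_def)
qed

section \<open>Rank-one matrices and proportionality\<close>

definition outer :: "'a::comm_ring_1 ^ 'm \<Rightarrow> 'a ^ 'n \<Rightarrow> 'a ^ 'n ^ 'm" where
  "outer u v = (\<chi> i j. u $ i * v $ j)"

lemma matrix_mult_outer: "A ** outer u v = outer (A *v u) v"
  by (simp add: outer_def matrix_matrix_mult_def matrix_vector_mult_def vec_eq_iff
      sum_distrib_right mult.assoc)

lemma outer_matrix_mult: "outer u v ** A = outer u (v v* A)"
  by (simp add: outer_def matrix_matrix_mult_def vector_matrix_mult_def vec_eq_iff
      sum_distrib_left mult.assoc mult.left_commute)

text \<open>If \<open>u v\<^sup>T C = I\<close>, then with \<open>x = v\<^sup>T C\<close> the products \<open>u\<^sub>i x\<^sub>j\<close> are the entries of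
  \<open>I\<close>, which is impossible as soon as there are two indices.\<close>

lemma not_invertible_outer:
  fixes u v :: "'a::field ^ 'n"
  assumes "CARD('n) \<ge> 2"
  shows "\<not> invertible (outer u v)"
proof
  assume "invertible (outer u v)"
  then obtain C where "outer u v ** C = mat 1" unfolding invertible_def by blast
  then have eq: "u $ i * (v v* C) $ j = (if i = j then 1 else 0)" for i j
    unfolding outer_matrix_mult unfolding outer_def mat_def vec_eq_iff by simp
  obtain a b :: 'n where "a \<noteq> b"
    using assms ex_card[OF assms] by (auto simp: card_2_iff)
  then show False using eq[of a a] eq[of b b] eq[of a b] by simp (metis mult_zero_left mult_zero_right zero_neq_one mult_eq_0_iff)
qed

text \<open>Stated by minors, proportionality is visibly closed and polynomial. It then includes
  the case that one of the matrices is zero.\<close>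

definition proportional :: "'a::comm_ring_1 ^ 'n ^ 'm \<Rightarrow> 'a ^ 'n ^ 'm \<Rightarrow> bool" where
  "proportional A B \<longleftrightarrow> (\<forall>i j k l. A $ i $ j * B $ k $ l = A $ k $ l * B $ i $ j)"

lemma proportional_imp_scaled:
  fixes A B :: "'a::field ^ 'n ^ 'm"
  assumes "proportional A B" "A \<noteq> 0"
  shows "\<exists>c. \<forall>i j. B $ i $ j = c * A $ i $ j"
proof -
  obtain i j where nz: "A $ i $ j \<noteq> 0" using assms(2) by (auto simp: vec_eq_iff)
  have "B $ k $ l = (B $ i $ j / A $ i $ j) * A $ k $ l" for k l
  proof -
    have "A $ i $ j * B $ k $ l = A $ k $ l * B $ i $ j"
      using assms(1) unfolding proportional_def by blast
    then show ?thesis using nz by (simp add: field_simps)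
  qed
  then show ?thesis by blast
qed

lemma not_invertible_if_proportional_outer:
  fixes u v :: "'a::field ^ 'n"
  assumes "proportional (outer u v) B" "outer u v \<noteq> 0" "CARD('n) \<ge> 2"
  shows "\<not> invertible B"
proof -
  obtain c where "\<forall>i j. B $ i $ j = c * outer u v $ i $ j"
    using proportional_imp_scaled assms by blast
  then have "B = outer (\<chi> i. c * u $ i) v"
    by (simp add: outer_def vec_eq_iff mult.assoc)
  then show ?thesis using not_invertible_outer[OF assms(3)] by simp
qed

definition rat_matrix :: "rat ^ 'n ^ 'm \<Rightarrow> real ^ 'n ^ 'm" where
  "rat_matrix Q = (\<chi> i j. of_rat (Q $ i $ j))"

lemma invertible_imp_nonzero:
  fixes A :: "'a::field ^ 'n ^ 'n"
  assumes "invertible A"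
  shows "A \<noteq> 0"
proof
  assume "A = 0"
  then obtain C :: "'a ^ 'n ^ 'n" where "0 ** C = (mat 1 :: 'a ^ 'n ^ 'n)"
    using assms unfolding invertible_def by blast
  then have "((0 :: 'a ^ 'n ^ 'n) ** C) $ undefined $ undefined = (mat 1 :: 'a ^ 'n ^ 'n) $ undefined $ undefined"
    by (simp only:)
  then show False by (simp add: matrix_matrix_mult_def mat_def)
qed

lemma invertible_scaleR:
  fixes A :: "real ^ 'n ^ 'n"
  assumes "invertible A" "c \<noteq> 0"
  shows "invertible (c *\<^sub>R A)"
proof -
  obtain C where "A ** C = mat 1" "C ** A = mat 1" using assms(1) unfolding invertible_def by blast
  then have "(c *\<^sub>R A) ** (inverse c *\<^sub>R C) = mat 1 \<and> (inverse c *\<^sub>R C) ** (c *\<^sub>R A) = mat 1"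
    using assms(2) by (simp add: scalar_matrix_assoc[symmetric] matrix_scalar_ac)
  then show ?thesis unfolding invertible_def by blast
qed

text \<open>This splits projective rationality into countably many closed conditions.\<close>

lemma projectively_rational_iff:
  fixes A :: "real ^ 'n ^ 'n"
  assumes "invertible A"
  shows "projectively_rational A \<longleftrightarrow> (\<exists>Q. invertible (rat_matrix Q) \<and> proportional A (rat_matrix Q))"
proof
  assume "projectively_rational A"
  then obtain c where c: "c \<noteq> 0" "\<forall>i j. \<exists>q. (c *\<^sub>R A) $ i $ j = of_rat q"
    unfolding projectively_rational_def Rats_def by blast
  then obtain q where q: "\<And>i j. (c *\<^sub>R A) $ i $ j = of_rat (q i j)" by metis
  have "rat_matrix (\<chi> i j. q i j) = c *\<^sub>R A"
    using q by (simp add: rat_matrix_def vec_eq_iff)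
  moreover have "proportional A (c *\<^sub>R A)" by (simp add: proportional_def)
  ultimately show "\<exists>Q. invertible (rat_matrix Q) \<and> proportional A (rat_matrix Q)"
    using invertible_scaleR[OF assms c(1)] by metis
next
  assume "\<exists>Q. invertible (rat_matrix Q) \<and> proportional A (rat_matrix Q)"
  then obtain Q where Q: "invertible (rat_matrix Q)" "proportional A (rat_matrix Q)" by blast
  obtain c where c: "\<forall>i j. rat_matrix Q $ i $ j = c * A $ i $ j"
    using proportional_imp_scaled[OF Q(2) invertible_imp_nonzero[OF assms]] by blast
  then have "c \<noteq> 0" using invertible_imp_nonzero[OF Q(1)] by (auto simp: vec_eq_iff)
  moreover have "(c *\<^sub>R A) $ i $ j \<in> \<rat>" for i j
    using c[rule_format, of i j, symmetric] by (simp add: rat_matrix_def)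
  ultimately show "projectively_rational A" unfolding projectively_rational_def by blast
qed

section \<open>Reflection words with denominators cleared\<close>

definition cmat :: "real ^ 'n ^ 'm \<Rightarrow> complex ^ 'n ^ 'm" where
  "cmat A = (\<chi> i j. of_real (A $ i $ j))"

lemma cmat_mult: "cmat (A ** B) = cmat A ** cmat B"
  by (simp add: cmat_def matrix_matrix_mult_def vec_eq_iff)

lemma cmat_one: "cmat (mat 1) = mat 1"
  by (simp add: cmat_def mat_def vec_eq_iff)

lemma invertible_cmat: "invertible A \<Longrightarrow> invertible (cmat A)"
  unfolding invertible_def by (metis cmat_mult cmat_one)

text \<open>The matrix \<open>(n \<bullet> n) I - 2 n n\<^sup>T\<close>, with the bilinear (not Hermitian) extension of the
  inner product to complex vectors, so that its entries are polynomials in \<open>n\<close>.\<close>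

definition cleared_reflection :: "complex ^ 'd \<Rightarrow> complex ^ 'd ^ 'd" where
  "cleared_reflection n = (\<chi> i j. (if i = j then \<Sum>k\<in>UNIV. n $ k * n $ k else 0) - 2 * (n $ i * n $ j))"

definition normal_of :: "('s \<times> 'd \<Rightarrow> complex) \<Rightarrow> 's \<Rightarrow> complex ^ 'd" where
  "normal_of v l = (\<chi> j. v (l, j))"

definition cleared_word :: "('s \<times> 'd \<Rightarrow> complex) \<Rightarrow> 's list \<Rightarrow> complex ^ 'd ^ 'd" where
  "cleared_word v w = foldr (\<lambda>l A. cleared_reflection (normal_of v l) ** A) w (mat 1)"

lemma polyfun_cleared_word: "polyfun (\<lambda>v. cleared_word v w $ i $ j)"
proof (induction w arbitrary: i j)
  case Nil
  show ?case by (simp add: cleared_word_def polyfun_const)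
next
  case (Cons l w)
  have "polyfun (\<lambda>v. if i = k then \<Sum>k\<in>UNIV. v (l, k) * v (l, k) else 0)" for k
    by (cases "i = k") (auto intro!: polyfun_sum polyfun_mult intro: polyfun_const polyfun_coord)
  then have "polyfun (\<lambda>v. cleared_reflection (normal_of v l) $ i $ k)" for k
    unfolding cleared_reflection_def normal_of_def
    by (simp only: vec_lambda_beta) (intro polyfun_diff polyfun_mult polyfun_const polyfun_coord)
  moreover have "cleared_word v (l # w) $ i $ j
      = (\<Sum>k\<in>UNIV. cleared_reflection (normal_of v l) $ i $ k * cleared_word v w $ k $ j)" for v
    by (simp add: cleared_word_def matrix_matrix_mult_def)
  ultimately show ?case using Cons by (auto intro!: polyfun_sum polyfun_mult)
qed

lemma reflection_proj: "x \<noteq> 0 \<Longrightarrow> reflection (proj x) = unit_reflection (sgn x)"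
  by (rule reflection.abs_eq) (auto simp: proj_rel_def intro: exI[of _ 1])

lemma cleared_reflection_of_real:
  fixes x :: "real ^ 'd"
  assumes "x \<noteq> 0"
  shows "cleared_reflection (\<chi> j. of_real (x $ j)) = (norm x)\<^sup>2 *\<^sub>R cmat (reflection (proj x))"
proof -
  have sq: "(norm x)\<^sup>2 = (\<Sum>k\<in>UNIV. x $ k * x $ k)"
    by (simp add: power2_norm_eq_inner inner_vec_def)
  have eq: "(norm x)\<^sup>2 * reflection (proj x) $ i $ j
      = (if i = j then \<Sum>k\<in>UNIV. x $ k * x $ k else 0) - 2 * (x $ i * x $ j)" for i j
    using assms unfolding sq[symmetric]
    by (simp add: reflection_proj unit_reflection_def sgn_div_norm mat_def field_simps power2_eq_square)
  show ?thesis
    unfolding vec_eq_iff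
  proof (intro allI)
    fix i j
    have "((norm x)\<^sup>2 *\<^sub>R cmat (reflection (proj x))) $ i $ j
        = of_real ((norm x)\<^sup>2 * reflection (proj x) $ i $ j)"
      by (simp add: cmat_def) (simp add: scaleR_conv_of_real)
    also have "\<dots> = cleared_reflection (\<chi> j. of_real (x $ j)) $ i $ j"
      unfolding eq by (simp add: cleared_reflection_def)
    finally show "cleared_reflection (\<chi> j. of_real (x $ j)) $ i $ j
        = ((norm x)\<^sup>2 *\<^sub>R cmat (reflection (proj x))) $ i $ j" by simp
  qed
qed

lemma cleared_word_of_real:
  assumes "\<And>l. x l \<noteq> 0" "\<And>l. c $ l = proj (x l)" "\<And>l. normal_of v l = (\<chi> j. of_real (x l $ j))"
  shows "\<exists>r. r \<noteq> 0 \<and> cleared_word v w = r *\<^sub>R cmat (word_reflection c w)"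
proof (induction w)
  case Nil
  show ?case by (auto simp: cleared_word_def word_reflection_def cmat_one intro!: exI[of _ 1])
next
  case (Cons l w)
  then obtain r where r: "r \<noteq> 0" "cleared_word v w = r *\<^sub>R cmat (word_reflection c w)" by blast
  have "cleared_word v (l # w) = cleared_reflection (normal_of v l) ** cleared_word v w"
    by (simp add: cleared_word_def)
  also have "\<dots> = (r * (norm (x l))\<^sup>2) *\<^sub>R cmat (word_reflection c (l # w))"
    using assms
    by (simp add: r(2) cleared_reflection_of_real word_reflection_def cmat_mult
        matrix_scalar_ac scalar_matrix_assoc[symmetric])
  finally show ?case using r(1) assms(1)[of l] by (intro exI[of _ "r * (norm (x l))\<^sup>2"]) simp
qed

lemma word_reflection_invertible:
  fixes c :: "'d::finite rproj ^ 's::finite"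
  shows "invertible (word_reflection c w)"
proof (induction w)
  case Nil
  show ?case by (auto simp: word_reflection_def invertible_def intro: exI[of _ "mat 1"])
next
  case (Cons l w)
  have "reflection r ** reflection r = mat 1" for r :: "'d rproj"
  proof (induction r rule: rproj.abs_induct)
    case (1 x)
    then have x: "x \<noteq> 0" by (simp add: proj_rel_def)
    define u where "u = sgn x"
    have u: "(\<Sum>k\<in>UNIV. u $ k * u $ k) = 1"
      using x norm_sgn[of x] power2_norm_eq_inner[of u] unfolding u_def[symmetric] by (simp add: inner_vec_def)
    have "(unit_reflection u ** unit_reflection u) $ i $ j = mat 1 $ i $ j" for i j
    proof -
      have "(unit_reflection u ** unit_reflection u) $ i $ j
          = (\<Sum>k\<in>UNIV. (if i = k then 1 else 0) * (if k = j then 1 else 0)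
              - (if i = k then 1 else 0) * (2 * (u $ k * u $ j))
              - (2 * (u $ i * u $ k)) * (if k = j then 1 else 0)
              + 4 * (u $ i * u $ j) * (u $ k * u $ k))"
        by (simp add: unit_reflection_def matrix_matrix_mult_def mat_def algebra_simps)
      also have "\<dots> = mat 1 $ i $ j"
        by (simp add: sum.distrib sum_subtractf sum_distrib_left[symmetric] u mat_def
            if_distrib[of "\<lambda>x. x * _"] if_distrib[of "\<lambda>x. _ * x"] cong: if_cong)
      finally show ?thesis .
    qed
    then show ?case using x by (simp add: reflection_proj u_def vec_eq_iff)
  qed
  then have "invertible (reflection (c $ l))" unfolding invertible_def by blast
  then show ?case using Cons
    by (simp add: word_reflection_def invertible_mult)
qed

section \<open>Degeneration at isotropic normals\<close>

definition cdot :: "complex ^ 'd \<Rightarrow> complex ^ 'd \<Rightarrow> complex" where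
  "cdot u v = (\<Sum>k\<in>UNIV. u $ k * v $ k)"

text \<open>Each factor is \<open>- 2 n n\<^sup>T\<close>, and multiplying two neighbours produces the scalar
  \<open>n\<^sub>l \<bullet> n\<^sub>l\<^sub>'\<close>, which is nonzero because neighbouring letters differ.\<close>

lemma cleared_word_isotropic:
  assumes "\<And>l. cdot (normal_of v l) (normal_of v l) = 0"
    and "\<And>l l'. l \<noteq> l' \<Longrightarrow> cdot (normal_of v l) (normal_of v l') \<noteq> 0"
    and "distinct_adj w" "w \<noteq> []"
  shows "\<exists>a. a \<noteq> 0 \<and> cleared_word v w = outer (\<chi> i. a * normal_of v (hd w) $ i) (normal_of v (last w))"
  using assms(3,4)
proof (induction w)
  case Nil
  then show ?case by simp
next
  case (Cons l w)
  have refl: "cleared_reflection (normal_of v l)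
      = outer (\<chi> i. - 2 * normal_of v l $ i) (normal_of v l)"
    using assms(1)[of l] by (simp add: cleared_reflection_def outer_def cdot_def vec_eq_iff)
  show ?case
  proof (cases w)
    case Nil
    then show ?thesis
      by (intro exI[of _ "-2"]) (simp add: cleared_word_def refl)
  next
    case (Cons l' w')
    then have "distinct_adj w" "w \<noteq> []" "l \<noteq> hd w" using Cons.prems by auto
    then obtain a where a: "a \<noteq> 0"
        "cleared_word v w = outer (\<chi> i. a * normal_of v (hd w) $ i) (normal_of v (last w))"
      using Cons.IH by blast
    let ?b = "-2 * a * cdot (normal_of v l) (normal_of v (hd w))"
    have "cleared_word v (l # w) = cleared_reflection (normal_of v l) ** cleared_word v w"
      by (simp add: cleared_word_def)
    also have "\<dots> = outer (\<chi> i. ?b * normal_of v l $ i) (normal_of v (last w))"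
      unfolding refl a(2) matrix_mult_outer
      by (simp add: outer_def matrix_vector_mult_def cdot_def vec_eq_iff sum_distrib_left
          sum_distrib_right algebra_simps)
    finally show ?thesis
      using a(1) assms(2)[OF \<open>l \<noteq> hd w\<close>] \<open>w \<noteq> []\<close> by (intro exI[of _ ?b]) simp
  qed
qed

text \<open>The points \<open>x\<close> of \<open>\<complex>\<^bsup>d-2\<^esup>\<close> parametrise isotropic vectors
  \<open>(x, (1 - x \<bullet> x) / 2, \<i> (1 + x \<bullet> x) / 2)\<close>, and the product of the vectors of \<open>x\<close> and \<open>y\<close> is
  \<open>- (x - y) \<bullet> (x - y) / 2\<close>. Distinct points \<open>x = (t, \<dots>, t)\<close> with integers \<open>t \<ge> 2\<close>
  therefore give vectors as required. That no coordinate vanishes allows them to be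
  normalised to \<open>1\<close> at any pivot, so that they lie in every affine chart.\<close>

lemma isotropic_family:
  assumes "CARD('d::finite) \<ge> 3"
  shows "\<exists>n :: 's::finite \<Rightarrow> complex ^ 'd.
    (\<forall>l. cdot (n l) (n l) = 0) \<and> (\<forall>l l'. l \<noteq> l' \<longrightarrow> cdot (n l) (n l') \<noteq> 0) \<and> (\<forall>l j. n l $ j \<noteq> 0)"
proof -
  obtain a b :: 'd where ab: "a \<noteq> b"
    using assms ex_card[of 2 "UNIV :: 'd set"] by (auto simp: card_2_iff)
  define m where "m = CARD('d) - 2"
  have m: "m > 0" using assms by (simp add: m_def)
  define N :: "complex \<Rightarrow> complex ^ 'd" where
    "N t = (\<chi> j. if j = a then (1 - of_nat m * t\<^sup>2) / 2
      else if j = b then \<i> * (1 + of_nat m * t\<^sup>2) / 2 else t)" for t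
  have dot: "cdot (N s) (N t) = - of_nat m * (s - t)\<^sup>2 / 2" for s t
  proof -
    have "cdot (N s) (N t) = N s $ a * N t $ a + (N s $ b * N t $ b + (\<Sum>k\<in>UNIV - {a} - {b}. N s $ k * N t $ k))"
      unfolding cdot_def using ab by (simp add: sum.remove[of _ a] sum.remove[of _ b])
    also have "(\<Sum>k\<in>UNIV - {a} - {b}. N s $ k * N t $ k) = (\<Sum>k\<in>UNIV - {a} - {b}. s * t)"
      by (rule sum.cong) (auto simp: N_def)
    also have "\<dots> = of_nat m * (s * t)"
      using ab by (simp add: m_def card_Diff_singleton numeral_2_eq_2)
    finally have "cdot (N s) (N t) = (1 - of_nat m * s\<^sup>2) / 2 * ((1 - of_nat m * t\<^sup>2) / 2)
        + (\<i> * (1 + of_nat m * s\<^sup>2) / 2 * (\<i> * (1 + of_nat m * t\<^sup>2) / 2) + of_nat m * (s * t))"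
      using ab by (simp add: N_def)
    also have "\<i> * (1 + of_nat m * s\<^sup>2) / 2 * (\<i> * (1 + of_nat m * t\<^sup>2) / 2)
        = - ((1 + of_nat m * s\<^sup>2) / 2 * ((1 + of_nat m * t\<^sup>2) / 2))"
      by (simp add: algebra_simps)
    finally have eq: "cdot (N s) (N t) = (1 - of_nat m * s\<^sup>2) / 2 * ((1 - of_nat m * t\<^sup>2) / 2)
        + (- ((1 + of_nat m * s\<^sup>2) / 2 * ((1 + of_nat m * t\<^sup>2) / 2)) + of_nat m * (s * t))" .
    show ?thesis
      unfolding eq by (simp add: power2_eq_square divide_simps) (simp add: algebra_simps)
  qed
  obtain h :: "'s \<Rightarrow> nat" where h: "inj h"
    using finite_imp_inj_to_nat_seg[of "UNIV :: 's set"] by auto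
  define n where "n l = N (of_nat (h l + 2))" for l
  \<comment> \<open>The shift by 2 keeps \<open>m t\<^sup>2\<close> above 1, so that \<open>1 - m t\<^sup>2\<close> does not vanish.\<close>
  have "N (of_nat (k + 2)) $ j \<noteq> 0" for k j
  proof -
    have "m * (k + 2)\<^sup>2 > 1" using m by (simp add: power2_eq_square)
    then have "of_nat (m * (k + 2)\<^sup>2) \<noteq> (1 :: complex)" "of_nat (m * (k + 2)\<^sup>2 + 1) \<noteq> (0 :: complex)"
      by (metis less_irrefl of_nat_eq_1_iff, metis add_is_0 of_nat_eq_0_iff one_neq_zero)
    then have "1 - of_nat m * (of_nat (k + 2))\<^sup>2 \<noteq> (0 :: complex)"
        "1 + of_nat m * (of_nat (k + 2))\<^sup>2 \<noteq> (0 :: complex)"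
      by (auto simp: add.commute)
    moreover have "of_nat (k + 2) \<noteq> (0 :: complex)" by (metis add_2_eq_Suc' nat.distinct(1) of_nat_eq_0_iff)
    ultimately show ?thesis by (simp add: N_def)
  qed
  moreover have "cdot (n l) (n l') \<noteq> 0" if "l \<noteq> l'" for l l'
    using that h m by (auto simp: n_def dot inj_def)
  ultimately show ?thesis by (intro exI[of _ n]) (simp add: n_def dot)
qed

section \<open>Resonance loci\<close>

definition resonance_locus ::
    "real ^ 'd ^ 'd \<Rightarrow> 's list \<Rightarrow> real ^ 'd ^ 'd \<Rightarrow> ('d::finite rproj ^ 's::finite) set" where
  "resonance_locus M w B = {c. proportional (M ** word_reflection c w ** matrix_inv M) B}"

lemma matrix_inv_mult:
  fixes A :: "real ^ 'n ^ 'n"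
  assumes "invertible A"
  shows "A ** matrix_inv A = mat 1" "matrix_inv A ** A = mat 1"
  using someI_ex[OF assms[unfolded invertible_def]] unfolding matrix_inv_def by auto

lemma nonresonant_iff:
  assumes "invertible M"
  shows "nonresonant M c \<longleftrightarrow>
    (\<forall>w Q. w \<noteq> [] \<and> distinct_adj w \<and> invertible (rat_matrix Q) \<longrightarrow> c \<notin> resonance_locus M w (rat_matrix Q))"
proof -
  have "invertible (M ** word_reflection c w ** matrix_inv M)" for w
    using matrix_inv_mult[OF assms] assms
    by (intro invertible_mult word_reflection_invertible) (auto simp: invertible_def)
  then show ?thesis
    unfolding nonresonant_def resonance_locus_def by (auto simp: projectively_rational_iff)
qed

lemma continuous_on_proj: "continuous_on (- {0}) (proj :: real ^ 'd::finite \<Rightarrow> 'd rproj)"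
proof -
  have "open (proj -` U \<inter> - {0 :: real ^ 'd})" if "open U" for U
    using that unfolding open_rproj_def by (simp add: vimage_def Int_def conj_commute)
  then show ?thesis by (subst continuous_on_open_vimage) auto
qed

text \<open>By definition of the quotient topology, continuity is checked on nonzero vectors.\<close>

lemma continuous_on_reflection: "continuous_on UNIV (reflection :: 'd::finite rproj \<Rightarrow> real ^ 'd ^ 'd)"
proof -
  have "continuous_on (- {0 :: real ^ 'd}) (\<lambda>x. unit_reflection (sgn x))"
    unfolding unit_reflection_def sgn_div_norm
    by (intro continuous_intros) auto
  then have *: "open ((\<lambda>x. unit_reflection (sgn x)) -` V \<inter> - {0 :: real ^ 'd})" if "open V" for V
    using that by (subst (asm) continuous_on_open_vimage) auto
  have "open (reflection -` V :: 'd rproj set)" if "open V" for V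
  proof -
    have "{x :: real ^ 'd. x \<noteq> 0 \<and> proj x \<in> reflection -` V} = (\<lambda>x. unit_reflection (sgn x)) -` V \<inter> - {0}"
      by (auto simp: reflection_proj)
    then show ?thesis using *[OF that] by (simp add: open_rproj_def)
  qed
  then show ?thesis by (simp add: continuous_on_open_vimage)
qed

lemma continuous_on_matrix_mult:
  fixes f g :: "'x::topological_space \<Rightarrow> real ^ 'n ^ 'n"
  assumes "continuous_on S f" "continuous_on S g"
  shows "continuous_on S (\<lambda>x. f x ** g x)"
  unfolding matrix_matrix_mult_def
  by (intro continuous_intros assms)

lemma continuous_on_word_reflection:
  "continuous_on UNIV (\<lambda>c :: 'd::finite rproj ^ 's::finite. word_reflection c w)"
proof (induction w)
  case Nil
  show ?case by (simp add: word_reflection_def)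
next
  case (Cons l w)
  have "continuous_on UNIV (\<lambda>c :: 'd rproj ^ 's. c $ l)"
    by (intro continuous_intros)
  then have "continuous_on UNIV (\<lambda>c :: 'd rproj ^ 's. reflection (c $ l))"
    by (rule continuous_on_compose2[OF continuous_on_reflection]) auto
  from continuous_on_matrix_mult[OF this Cons] show ?case
    by (simp add: word_reflection_def)
qed

lemma closed_resonance_locus: "closed (resonance_locus M w B)"
  unfolding resonance_locus_def proportional_def
  by (intro closed_Collect_all closed_Collect_eq continuous_intros continuous_on_matrix_mult
      continuous_on_word_reflection)

text \<open>In the chart the locus lies in the zero set of any single cleared minor, and at the
  isotropic point, where the word has rank one, one of these minors does not vanish.\<close>

lemma chart_resonance_locus_null:
  fixes M B :: "real ^ 'd::finite ^ 'd" and p :: "'s::finite \<Rightarrow> 'd"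
  assumes d: "CARD('d) \<ge> 3" and M: "invertible M" and B: "invertible B"
    and w: "w \<noteq> []" "distinct_adj w"
  shows "\<exists>N \<in> null_sets (Pi\<^sub>M (chart_index p) (\<lambda>_. lborel)).
    {y \<in> space (Pi\<^sub>M (chart_index p) (\<lambda>_. lborel)). chart_inv p y \<in> resonance_locus M w B} \<subseteq> N"
proof -
  let ?A = "\<lambda>v. cmat M ** cleared_word v w ** cmat (matrix_inv M)"
  obtain n :: "'s \<Rightarrow> complex ^ 'd" where n: "\<And>l. cdot (n l) (n l) = 0"
      "\<And>l l'. l \<noteq> l' \<Longrightarrow> cdot (n l) (n l') \<noteq> 0" "\<And>l j. n l $ j \<noteq> 0"
    using isotropic_family[OF d, where 's = 's] by blast
  \<comment> \<open>The isotropic point in the chart: every normal is rescaled to have pivot coordinate 1.\<close>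
  define z where "z = (\<lambda>(l, j). n l $ j / n l $ p l)"
  have dot: "cdot (normal_of z l) (normal_of z l') = cdot (n l) (n l') / (n l $ p l * n l' $ p l')" for l l'
    by (simp add: cdot_def normal_of_def z_def sum_divide_distrib)
  obtain a where a: "a \<noteq> 0"
      "cleared_word z w = outer (\<chi> i. a * normal_of z (hd w) $ i) (normal_of z (last w))"
    using cleared_word_isotropic[of z w] n w by (auto simp: dot)
  obtain u v where uv: "?A z = outer u v"
    unfolding a(2) matrix_mult_outer outer_matrix_mult by blast
  \<comment> \<open>At the pivots the two normals have coordinate 1, so this entry equals \<open>a\<close>.\<close>
  have "cleared_word z w $ p (hd w) $ p (last w) \<noteq> 0"
    using a n(3) by (simp add: outer_def normal_of_def z_def)
  then have "cleared_word z w \<noteq> 0" by auto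
  moreover have "cleared_word z w = cmat (matrix_inv M) ** ?A z ** cmat M"
  proof -
    have "cmat (matrix_inv M) ** ?A z ** cmat M
        = (cmat (matrix_inv M) ** cmat M) ** cleared_word z w ** (cmat (matrix_inv M) ** cmat M)"
      by (simp add: matrix_mul_assoc)
    then show ?thesis by (simp add: cmat_mult[symmetric] matrix_inv_mult[OF M] cmat_one)
  qed
  moreover have "cmat (matrix_inv M) ** 0 ** cmat M = 0"
    by (simp add: matrix_matrix_mult_def vec_eq_iff)
  ultimately have "?A z \<noteq> 0" by metis
  then have "\<not> proportional (?A z) (cmat B)"
    using not_invertible_if_proportional_outer[of u v "cmat B"] d invertible_cmat[OF B]
    unfolding uv by auto
  then obtain i j k l where nz: "?A z $ i $ j * cmat B $ k $ l - ?A z $ k $ l * cmat B $ i $ j \<noteq> 0"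
    unfolding proportional_def by auto
  define F where "F v = ?A v $ i $ j * cmat B $ k $ l - ?A v $ k $ l * cmat B $ i $ j" for v
  have "polyfun (\<lambda>v. ?A v $ i $ j)" for i j
    by (auto simp: matrix_matrix_mult_def
        intro!: polyfun_sum polyfun_mult polyfun_const polyfun_cleared_word)
  then have "polyfun F" unfolding F_def
    by (intro polyfun_diff polyfun_mult polyfun_const)
  then have "{y \<in> space (Pi\<^sub>M (chart_index p) (\<lambda>_. lborel)). F (real_slice (chart_index p) z y) = 0}
      \<in> null_sets (Pi\<^sub>M (chart_index p) (\<lambda>_. lborel))"
    by (rule polyfun_zeros_null[rotated]) (use nz in \<open>auto simp: F_def\<close>)
  moreover have "F (real_slice (chart_index p) z y) = 0" if "chart_inv p y \<in> resonance_locus M w B" for y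
  proof -
    let ?v = "real_slice (chart_index p) z y" and ?c = "chart_inv p y"
    define x :: "'s \<Rightarrow> real ^ 'd" where "x l = (\<chi> j. if j = p l then 1 else y (l, j))" for l
    have "x l \<noteq> 0" for l by (auto simp: x_def vec_eq_iff intro!: exI[of _ "p l"])
    moreover have "?c $ l = proj (x l)" for l by (simp add: chart_inv_def x_def)
    moreover have "normal_of ?v l = (\<chi> j. of_real (x l $ j))" for l
      using n(3) by (simp add: normal_of_def real_slice_def x_def z_def chart_index_def vec_eq_iff)
    ultimately obtain r where r: "cleared_word ?v w = r *\<^sub>R cmat (word_reflection ?c w)"
      using cleared_word_of_real by blast
    have A: "?A ?v = r *\<^sub>R cmat (M ** word_reflection ?c w ** matrix_inv M)"
      unfolding r by (simp add: cmat_mult matrix_scalar_ac scalar_matrix_assoc[symmetric])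
    have "proportional (M ** word_reflection ?c w ** matrix_inv M) B"
      using that by (simp add: resonance_locus_def)
    then have "(M ** word_reflection ?c w ** matrix_inv M) $ i $ j * B $ k $ l
        = (M ** word_reflection ?c w ** matrix_inv M) $ k $ l * B $ i $ j"
      unfolding proportional_def by blast
    then have "of_real ((M ** word_reflection ?c w ** matrix_inv M) $ i $ j * B $ k $ l)
        = (of_real ((M ** word_reflection ?c w ** matrix_inv M) $ k $ l * B $ i $ j) :: complex)"
      by (rule arg_cong)
    then show ?thesis unfolding F_def A by (simp add: cmat_def)
  qed
  ultimately show ?thesis by (intro bexI) auto
qed

lemma smooth_null_resonant:
  fixes M :: "real ^ 'd::finite ^ 'd"
  assumes d: "CARD('d) \<ge> 3" and M: "invertible M"
  shows "smooth_null {c :: 'd rproj ^ 's::finite. \<not> nonresonant M c}"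
  unfolding smooth_null_def Let_def
proof
  fix p :: "'s \<Rightarrow> 'd"
  let ?M = "Pi\<^sub>M (chart_index p) (\<lambda>_. lborel :: real measure)"
  define I where "I = {(w :: 's list, Q :: rat ^ 'd ^ 'd). w \<noteq> [] \<and> distinct_adj w \<and> invertible (rat_matrix Q)}"
  let ?bad = "\<lambda>t. {y \<in> space ?M. chart_inv p y \<in> resonance_locus M (fst t) (rat_matrix (snd t))}"
  have "\<exists>N. N \<in> null_sets ?M \<and> ?bad t \<subseteq> N" if "t \<in> I" for t
  proof -
    have "fst t \<noteq> []" "distinct_adj (fst t)" "invertible (rat_matrix (snd t))"
      using that by (auto simp: I_def)
    then show ?thesis using chart_resonance_locus_null[OF d M] by blast
  qed
  then have "\<exists>N. \<forall>t\<in>I. N t \<in> null_sets ?M \<and> ?bad t \<subseteq> N t"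
    by (intro bchoice ballI)
  then obtain N where N: "\<And>t. t \<in> I \<Longrightarrow> N t \<in> null_sets ?M" "\<And>t. t \<in> I \<Longrightarrow> ?bad t \<subseteq> N t"
    by blast
  have "(\<Union>t\<in>I. N t) \<in> null_sets ?M"
    by (intro null_sets_UN' N) auto
  then have "(\<Union>t\<in>I. N t) \<in> null_sets (completion ?M)"
    by (rule null_sets_completionI)
  moreover have "{y \<in> space ?M. chart_inv p y \<in> {c. \<not> nonresonant M c}} \<subseteq> (\<Union>t\<in>I. N t)"
  proof safe
    fix y assume y: "y \<in> space ?M" "\<not> nonresonant M (chart_inv p y)"
    then obtain w Q where "w \<noteq> []" "distinct_adj w" "invertible (rat_matrix Q)"
        "chart_inv p y \<in> resonance_locus M w (rat_matrix Q)"
      unfolding nonresonant_iff[OF M] by blast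
    then have "(w, Q) \<in> I" "y \<in> N (w, Q)"
      using y(1) N(2)[of "(w, Q)"] by (auto simp: I_def)
    then show "y \<in> (\<Union>t\<in>I. N t)" by blast
  qed
  ultimately show "{y \<in> space ?M. chart_inv p y \<in> {c. \<not> nonresonant M c}} \<in> null_sets (completion ?M)"
    by (rule null_sets_completion_subset[rotated])
qed

section \<open>Open sets are not null\<close>

lemma smooth_null_subset:
  assumes "smooth_null N" "N' \<subseteq> N"
  shows "smooth_null N'"
  using assms unfolding smooth_null_def Let_def
  by (blast intro: null_sets_completion_subset[rotated])

lemma chart_inv_surj:
  fixes c :: "'d::finite rproj ^ 's::finite"
  shows "\<exists>p y. y \<in> extensional (chart_index p) \<and> c = chart_inv p y"
proof -
  have "\<exists>x. x \<noteq> 0 \<and> r = proj x" for r :: "'d rproj"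
    by (induction r rule: rproj.abs_induct) (auto simp: proj_rel_def)
  then have "\<forall>l. \<exists>x. x \<noteq> 0 \<and> c $ l = proj x" by blast
  then obtain x where x: "\<And>l. x l \<noteq> 0" "\<And>l. c $ l = proj (x l)" by (auto dest!: choice)
  then have "\<exists>j. x l $ j \<noteq> 0" for l by (auto simp: vec_eq_iff)
  then obtain p where p: "\<And>l. x l $ p l \<noteq> 0" by metis
  define y where "y = restrict (\<lambda>(l, j). x l $ j / x l $ p l) (chart_index p)"
  have "proj (x l) = proj (\<chi> j. if j = p l then 1 else y (l, j))" for l
  proof (rule Quotient3_rel_abs[OF Quotient3_rproj])
    have "(\<chi> j. if j = p l then 1 else y (l, j)) = inverse (x l $ p l) *\<^sub>R x l"
      using p[of l] by (simp add: vec_eq_iff y_def chart_index_def field_simps)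
    then show "proj_rel (x l) (\<chi> j. if j = p l then 1 else y (l, j))"
      using x(1)[of l] p[of l] by (auto simp: proj_rel_def intro!: exI[of _ "inverse (x l $ p l)"])
  qed
  then have "c = chart_inv p y" using x(2) by (simp add: chart_inv_def vec_eq_iff)
  then show ?thesis unfolding y_def by blast
qed

lemma continuous_on_chart_inv:
  fixes p :: "'s::finite \<Rightarrow> 'd::finite"
  shows "continuous_on UNIV (chart_inv p)"
proof -
  have "continuous_on UNIV (\<lambda>y. proj (\<chi> j. if j = p l then 1 else y (l, j)))" for l
  proof (rule continuous_on_compose2[OF continuous_on_proj])
    have "continuous_on UNIV (\<lambda>y :: 's \<times> 'd \<Rightarrow> real. if j = p l then 1 else y (l, j))" for j
      by (cases "j = p l") simp_all
    then show "continuous_on UNIV (\<lambda>y :: 's \<times> 'd \<Rightarrow> real. \<chi> j. if j = p l then 1 else y (l, j))"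
      by (intro continuous_intros)
    have "(\<chi> j. if j = p l then 1 else y (l, j)) $ p l \<noteq> (0 :: real ^ 'd) $ p l" for y
      by simp
    then have "(\<chi> j. if j = p l then 1 else y (l, j)) \<noteq> (0 :: real ^ 'd)" for y
      by metis
    then show "range (\<lambda>y :: 's \<times> 'd \<Rightarrow> real. \<chi> j. if j = p l then 1 else y (l, j)) \<subseteq> - {0}"
      unfolding image_subset_iff by (intro ballI) simp
  qed
  then show ?thesis unfolding chart_inv_def by (intro continuous_on_vec_lambda)
qed

text \<open>In a chart around one of its points, a nonempty open set contains a box of nonempty open
  sets, whose measure is a product of positive numbers.\<close>

lemma open_smooth_null_empty:
  fixes V :: "('d::finite rproj ^ 's::finite) set"
  assumes "open V" "smooth_null V"
  shows "V = {}"
proof (rule ccontr)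
  assume "V \<noteq> {}"
  then obtain p y where y: "y \<in> extensional (chart_index p)" "chart_inv p y \<in> V"
    using chart_inv_surj by (metis ex_in_conv)
  interpret product_sigma_finite "\<lambda>_ :: 's \<times> 'd. lborel :: real measure" ..
  let ?M = "Pi\<^sub>M (chart_index p) (\<lambda>_. lborel :: real measure)"
  have "open (chart_inv p -` V)"
    using continuous_on_chart_inv[of p] assms(1) by (simp add: continuous_on_open_vimage)
  \<comment> \<open>The product topology is that of all coordinates. Those outside the chart are
    \<open>undefined\<close>, for \<open>y\<close> as for every point of the measure space, and so impose no condition.\<close>
  then have "\<exists>X. y \<in> Pi\<^sub>E UNIV X \<and> (\<forall>i. openin euclidean (X i)) \<and>
      finite {i. X i \<noteq> topspace euclidean} \<and> Pi\<^sub>E UNIV X \<subseteq> chart_inv p -` V"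
    using y unfolding open_fun_def by (intro product_topology_open_contains_basis) auto
  then obtain X where X: "\<And>i. y i \<in> X i" "\<And>i. open (X i)" "Pi\<^sub>E UNIV X \<subseteq> chart_inv p -` V"
    by auto
  have "Pi\<^sub>E (chart_index p) X \<subseteq> {y \<in> space ?M. chart_inv p y \<in> V}"
  proof
    fix y' assume y': "y' \<in> Pi\<^sub>E (chart_index p) X"
    then have "y' i \<in> X i" for i
      using X(1)[of i] y(1) PiE_mem[OF y', of i] PiE_arb[OF y', of i] extensional_arb[OF y(1), of i]
      by (cases "i \<in> chart_index p") auto
    then have "y' \<in> Pi\<^sub>E UNIV X" by (simp add: PiE_iff)
    then have "chart_inv p y' \<in> V" using X(3) by blast
    then show "y' \<in> {y \<in> space ?M. chart_inv p y \<in> V}"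
      using y' by (auto simp: space_PiM PiE_def)
  qed
  moreover have "{y \<in> space ?M. chart_inv p y \<in> V} \<in> null_sets (completion ?M)"
    using assms(2) unfolding smooth_null_def Let_def by blast
  ultimately have "Pi\<^sub>E (chart_index p) X \<in> null_sets (completion ?M)"
    by (rule null_sets_completion_subset)
  moreover have sets: "Pi\<^sub>E (chart_index p) X \<in> sets ?M"
    using X(2) by (intro sets_PiM_I_finite) auto
  ultimately have "emeasure ?M (Pi\<^sub>E (chart_index p) X) = 0"
    by (simp add: null_sets_def)
  then have "(\<Prod>i\<in>chart_index p. emeasure lborel (X i)) = 0"
    using X(2) by (subst (asm) emeasure_PiM) auto
  then obtain i where "emeasure lborel (X i) = 0" by auto
  then have "X i \<in> null_sets lborel" using X(2) by (auto simp: null_sets_def)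
  then have "negligible (X i)"
    by (simp add: negligible_iff_null_sets null_sets_completionI)
  then show False using open_not_negligible[OF X(2), of i] X(1)[of i] by auto
qed

theorem proposition1:
  fixes M\<^sub>0 :: "real ^ 'd ^ 'd"
    and U :: "('d::finite rproj ^ 's::finite) set"
  assumes "CARD('d) \<ge> 3"
    and "det M\<^sub>0 = 1"
    and "open_realisation_stratum U"
  shows "smooth_null (U - {c \<in> U. nonresonant M\<^sub>0 c})
    \<and> U \<subseteq> closure {c \<in> U. nonresonant M\<^sub>0 c}
    \<and> gdelta_in (top_of_set U) {c \<in> U. nonresonant M\<^sub>0 c}"
proof (intro conjI)
  let ?S = "{c \<in> U. nonresonant M\<^sub>0 c}"
  have M: "invertible M\<^sub>0" using assms(2) by (simp add: invertible_det_nz)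
  have U: "open U" using assms(3) by (simp add: open_realisation_stratum_def)
  show null: "smooth_null (U - ?S)"
    by (rule smooth_null_subset[OF smooth_null_resonant[OF assms(1) M]]) auto
  have "U - closure ?S \<subseteq> U - ?S" using closure_subset[of ?S] by blast
  then have "smooth_null (U - closure ?S)" by (rule smooth_null_subset[OF null])
  moreover have "open (U - closure ?S)" using U by (intro open_Diff closed_closure)
  ultimately show "U \<subseteq> closure ?S" using open_smooth_null_empty by blast
  define I where "I = {(w :: 's list, Q :: rat ^ 'd ^ 'd). w \<noteq> [] \<and> distinct_adj w \<and> invertible (rat_matrix Q)}"
  define T where "T = insert U ((\<lambda>(w, Q). U - resonance_locus M\<^sub>0 w (rat_matrix Q)) ` I)"
  have "gdelta_in (top_of_set U) (\<Inter>T)"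
  proof (rule gdelta_in_Inter)
    show "countable T" unfolding T_def by simp
    show "T \<noteq> {}" unfolding T_def by simp
    fix S assume "S \<in> T"
    then have "open S" "S \<subseteq> U"
      using U closed_resonance_locus unfolding T_def by (auto intro: open_Diff)
    then show "gdelta_in (top_of_set U) S"
      by (intro open_imp_gdelta_in) (auto simp: openin_open)
  qed
  moreover have "\<Inter>T = ?S"
    unfolding T_def I_def by (auto simp: nonresonant_iff[OF M])
  ultimately show "gdelta_in (top_of_set U) ?S" by simp
qed

end
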